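(* Let $G$ be a finite-dimensional Lie group with Lie algebra $\mathfrak g$, acting on the left by a representation on a finite-dimensional vector space $V$ and by the induced representation on $V^*$. Let $a_0\in V^*$ and let $h,h_1,\dots,h_N:\mathfrak g^*\times\mathrm{Orb}(a_0)\to\mathbb R$ be smooth reduced Hamiltonians (of $G_{a_0}$-invariant Hamiltonians on $T^*G$). Then the discrete flow of the stochastic midpoint integrator with advected parameter (described in the context), $(\mu_0,\alpha_0)\mapsto(\mu_k,\alpha_k)$, preserves the coadjoint orbits of the semidirect product group $G\,\circledS\,V$ in $(\mathfrak g\,\circledS\,V)^*$: $(\mu_k,\alpha_k)\in\mathcal O(\mu_0,\alpha_0)$ for all $k$, where $$\mathcal O(\mu_0,\alpha_0)=\{(\mathrm{Ad}^*_g(\mu_0-u\diamond\alpha_0),\,g^{-1}\cdot\alpha_0)\mid(g,u)\in G\,\circledS\,V\}.$$ It also preserves the Casimirs of the Lie–Poisson bracket on $(\mathfrak g\,\circledS\,V)^*$.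
   Context: Conventions. $\langle g\cdot\alpha,v\rangle=\langle\alpha,g^{-1}\cdot v\rangle$; $\mathrm{Orb}(a_0)\subset V^*$ is the $G$-orbit of $a_0$, $G_{a_0}$ its isotropy group. The diamond operation $\diamond:V\times V^*\to\mathfrak g^*$ is $\langle v\diamond\alpha,\xi\rangle=-\langle v,\xi\cdot\alpha\rangle=\langle\xi\cdot v,\alpha\rangle$. The semidirect product $G\,\circledS\,V$ has multiplication $(g,u)(h,v)=(gh,g\cdot v+u)$; its coadjoint action is $\mathrm{Ad}^*_{(g,u)}(\mu,\alpha)=(\mathrm{Ad}^*_g(\mu-u\diamond\alpha),g^{-1}\cdot\alpha)$. Casimirs are taken to be functions constant on coadjoint orbits. $\langle\mathrm{Ad}^*_g\mu,\eta\rangle=\langle\mu,\mathrm{Ad}_g\eta\rangle$. A retraction map $\tau:\mathfrak g\to G$ is a local diffeomorphism (near $0$) with $\tau(0)=e$. For $\xi,\eta\in\mathfrak g$, $g=\tau(\xi)$: $\mathrm d_\xi\tau^{-1}(\eta):=\mathrm D\tau^{-1}(g)\cdot(\eta g)$, with dual $[\mathrm d_\xi\tau^{-1}]^*$. $\partial h/\partial\alpha\in V$ is the derivative of any smooth extension of $h$ to $\mathfrak g^*\times V^*$; $\frac{\partial h}{\partial\alpha}\diamond\alpha$ does not depend on the extension. Scheme. Fix a retraction map $\tau$. Let $\Delta t>0$, $M\ge1$, $\Delta W^i_k$ ($k=1,\dots,M$) the increments of independent Wiener processes over the $k$-th step (everything is pathwise), and $\mathsf h_k:=h+\sum_{i=1}^Nh_i\,\Delta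 W^i_k/\Delta t$. The unknowns are $g_k,\tilde g_k\in G$ and $\tilde\mu_k^1,\tilde\mu_k^2\in\mathfrak g^*$. Set $\tilde\alpha_k=\tilde g_k^{-1}\cdot a_0$ ($1\le k\le M$), $\alpha_k=g_k^{-1}\cdot a_0$ ($0\le k\le M$), $\Delta t\,\xi_k=\tau^{-1}(\tilde g_k^{-1}g_k)$, $\Delta t\,\tilde\xi_k=\tau^{-1}(g_{k-1}^{-1}\tilde g_k)$. With derivatives of $\mathsf h_k$ evaluated at $(\frac{\tilde\mu_k^1+\tilde\mu_k^2}2,\tilde\alpha_k)$, the integrator is $$\tfrac1{\Delta t}\big(\mathrm{Ad}^*_{\tau(\Delta t\tilde\xi_k)}[\mathrm d_{\Delta t\tilde\xi_k}\tau^{-1}]^*\tilde\mu^1_k-[\mathrm d_{\Delta t\xi_k}\tau^{-1}]^*\tilde\mu^2_k\big)=\tfrac{\partial\mathsf h_k}{\partial\alpha}\diamond\tilde\alpha_k,\qquad\tilde\xi_k=\xi_k=\tfrac12\tfrac{\partial\mathsf h_k}{\partial\mu}\quad(k=1,\dots,M),$$ $$\mathrm{Ad}^*_{\tau(\Delta t\xi_k)}[\mathrm d_{\Delta t\xi_k}\tau^{-1}]^*\tilde\mu^2_k=[\mathrm d_{\Delta t\tilde\xi_{k+1}}\tau^{-1}]^*\tilde\mu^1_{k+1}\quad(k=1,\dots,M-1).$$ The trivialized momenta are $\mu_k=[\mathrm d_{\Delta t\tilde\xi_{k+1}}\tau^{-1}]^*\tilde\mu^1_{k+1}$ for $0\le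 k\le M-1$ and $\mu_k=\mathrm{Ad}^*_{\tau(\Delta t\xi_k)}[\mathrm d_{\Delta t\xi_k}\tau^{-1}]^*\tilde\mu^2_k$ for $1\le k\le M$ (the two agree when both apply). Standing assumption: the implicit equations are solvable with all arguments of $\tau^{-1}$ in its domain. *)

theory Defs
  imports "HOL-Probability.Probability" "HOL-Algebra.Group_Action"
begin

section \<open>Smooth maps and manifolds\<close>

text \<open>
  Finite-dimensional real vector spaces are types of class \<open>real_normed_vector\<close> satisfying
  \<open>fin_dim\<close>. The norm is auxiliary, and unlike with the class \<open>euclidean_space\<close> the zero space is
  admitted (so 0-dimensional Lie groups and the zero representation are covered). The dual of
  \<open>'a\<close> is \<^typ>\<open>'a \<Rightarrow>\<^sub>L real\<close>.
\<close>

definition fin_dim :: "'a::real_vector itself \<Rightarrow> bool" where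
  "fin_dim _ \<longleftrightarrow> (\<exists>B::'a set. finite B \<and> span B = UNIV)"

text \<open>\<open>C\<^sup>k\<close> and \<open>C\<^sup>\<infinity>\<close> on an \<^emph>\<open>open\<close> subset \<open>S\<close> of a finite-dimensional space.\<close>

primrec Ck_on :: "nat \<Rightarrow> 'a::real_normed_vector set \<Rightarrow> ('a \<Rightarrow> 'b::real_normed_vector) \<Rightarrow> bool" where
  "Ck_on 0 S f \<longleftrightarrow> continuous_on S f"
| "Ck_on (Suc k) S f \<longleftrightarrow>
     (\<forall>x\<in>S. f differentiable (at x)) \<and> (\<forall>v. Ck_on k S (\<lambda>x. frechet_derivative f (at x) v))"

definition smooth_on :: "'a::real_normed_vector set \<Rightarrow> ('a \<Rightarrow> 'b::real_normed_vector) \<Rightarrow> bool" where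
  "smooth_on S f \<longleftrightarrow> (\<forall>k. Ck_on k S f)"

text \<open>A chart is a domain together with a coordinate map (only its values on the domain matter).
  A manifold is a topology with a smooth atlas, which need not be maximal.\<close>

type_synonym ('m, 'e) chart = "'m set \<times> ('m \<Rightarrow> 'e)"
type_synonym ('m, 'e) manifold = "'m topology \<times> ('m, 'e) chart set"

definition is_chart :: "'m topology \<Rightarrow> ('m, 'e::real_normed_vector) chart \<Rightarrow> bool" where
  "is_chart T = (\<lambda>(U, \<phi>). openin T U \<and> open (\<phi> ` U) \<and>
     homeomorphic_map (subtopology T U) (top_of_set (\<phi> ` U)) \<phi>)"

definition smooth_manifold :: "('m, 'e::real_normed_vector) manifold \<Rightarrow> bool" where
  "smooth_manifold = (\<lambda>(T, \<A>). fin_dim TYPE('e) \<and> Hausdorff_space T \<and> second_countable T \<and>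
     (\<forall>c\<in>\<A>. is_chart T c) \<and> (\<Union>c\<in>\<A>. fst c) = topspace T \<and>
     (\<forall>(U, \<phi>)\<in>\<A>. \<forall>(V, \<psi>)\<in>\<A>. smooth_on (\<phi> ` (U \<inter> V)) (\<psi> \<circ> inv_into U \<phi>)))"

definition vec_mfd :: "('a::real_normed_vector, 'a) manifold" where
  "vec_mfd = (euclidean, {(UNIV, id)})"

definition open_submfd :: "('m, 'e) manifold \<Rightarrow> 'm set \<Rightarrow> ('m, 'e) manifold" where
  "open_submfd = (\<lambda>(T, \<A>) W. (subtopology T W, {(U \<inter> W, \<phi>) | U \<phi>. (U, \<phi>) \<in> \<A>}))"

definition prod_mfd :: "('m, 'e) manifold \<Rightarrow> ('n, 'f) manifold \<Rightarrow> ('m \<times> 'n, 'e \<times> 'f) manifold" where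
  "prod_mfd = (\<lambda>(T, \<A>) (T', \<A>').
     (prod_topology T T',
      {(U \<times> V, map_prod \<phi> \<psi>) | U \<phi> V \<psi>. (U, \<phi>) \<in> \<A> \<and> (V, \<psi>) \<in> \<A>'}))"

definition smooth_map ::
  "('m, 'e::real_normed_vector) manifold \<Rightarrow> ('n, 'f::real_normed_vector) manifold \<Rightarrow> ('m \<Rightarrow> 'n) \<Rightarrow> bool" where
  "smooth_map = (\<lambda>(T, \<A>) (T', \<A>') F. continuous_map T T' F \<and>
     (\<forall>(U, \<phi>)\<in>\<A>. \<forall>(V, \<psi>)\<in>\<A>'. smooth_on (\<phi> ` {p \<in> U. F p \<in> V}) (\<psi> \<circ> F \<circ> inv_into U \<phi>)))"

definition diffeomorphism ::
  "('m, 'e::real_normed_vector) manifold \<Rightarrow> ('n, 'f::real_normed_vector) manifold \<Rightarrow>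
    ('m \<Rightarrow> 'n) \<Rightarrow> ('n \<Rightarrow> 'm) \<Rightarrow> bool" where
  "diffeomorphism M N F F' \<longleftrightarrow> smooth_map M N F \<and> smooth_map N M F' \<and>
     (\<forall>p\<in>topspace (fst M). F' (F p) = p) \<and> (\<forall>q\<in>topspace (fst N). F (F' q) = q)"


section \<open>Lie groups\<close>

text \<open>
  The model space \<open>'e\<close> of the manifold also serves as the Lie algebra: the differential at the
  identity of the distinguished chart \<open>e_chart\<close> identifies the tangent space of \<open>G\<close> at the identity
  with \<open>'e\<close>. As \<open>e_chart\<close> is arbitrary, this is no restriction. The bracket is not needed.
\<close>

record ('g, 'e) lie_struct = "'g monoid" +
  mfd :: "('g, 'e) manifold"
  e_chart :: "('g, 'e) chart"

locale lie_group = group G for G :: "('g, 'e::real_normed_vector) lie_struct" (structure) +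
  assumes manifold: "smooth_manifold (mfd G)"
    and topspace_eq: "topspace (fst (mfd G)) = carrier G"
    and smooth_mult: "smooth_map (prod_mfd (mfd G) (mfd G)) (mfd G) (\<lambda>(g, h). g \<otimes> h)"
    and smooth_inv: "smooth_map (mfd G) (mfd G) (\<lambda>g. inv g)"
    and e_chart_in_atlas: "e_chart G \<in> snd (mfd G)"
    and e_chart_at_one: "\<one> \<in> fst (e_chart G)"

definition e_coord :: "('g, 'e) lie_struct \<Rightarrow> 'g \<Rightarrow> 'e" where
  "e_coord G = snd (e_chart G)"

definition e_param :: "('g, 'e) lie_struct \<Rightarrow> 'e \<Rightarrow> 'g" where
  "e_param G = inv_into (fst (e_chart G)) (snd (e_chart G))"

text \<open>
  \<open>right_deriv G F g \<eta>\<close> is \<open>DF(g) \<cdot> (\<eta>g)\<close> for a vector-valued \<open>F\<close> defined near \<open>g\<close>, where \<open>\<eta>g\<close> is the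
  right translate to \<open>g\<close> of the Lie algebra element \<open>\<eta>\<close>: the composite of \<open>F\<close> with right
  multiplication by \<open>g\<close> is differentiated at the identity.
\<close>

definition right_deriv ::
  "('g, 'e::real_normed_vector) lie_struct \<Rightarrow> ('g \<Rightarrow> 'a::real_normed_vector) \<Rightarrow> 'g \<Rightarrow> 'e \<Rightarrow> 'a" where
  "right_deriv G F g \<eta> =
     frechet_derivative (\<lambda>x. F (e_param G x \<otimes>\<^bsub>G\<^esub> g)) (at (e_coord G \<one>\<^bsub>G\<^esub>)) \<eta>"

definition Ad :: "('g, 'e::real_normed_vector) lie_struct \<Rightarrow> 'g \<Rightarrow> 'e \<Rightarrow> 'e" where
  "Ad G g \<eta> = right_deriv G (\<lambda>x. e_coord G (g \<otimes>\<^bsub>G\<^esub> x \<otimes>\<^bsub>G\<^esub> inv\<^bsub>G\<^esub> g)) \<one>\<^bsub>G\<^esub> \<eta>"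

definition Ad_star ::
  "('g, 'e::real_normed_vector) lie_struct \<Rightarrow> 'g \<Rightarrow> ('e \<Rightarrow>\<^sub>L real) \<Rightarrow> ('e \<Rightarrow>\<^sub>L real)" where
  "Ad_star G g \<mu> = \<mu> o\<^sub>L Blinfun (Ad G g)"


section \<open>Representations and the semidirect product\<close>

definition lie_representation ::
  "('g, 'e::real_normed_vector) lie_struct \<Rightarrow> ('g \<Rightarrow> 'v::real_normed_vector \<Rightarrow> 'v) \<Rightarrow> bool" where
  "lie_representation G \<rho> \<longleftrightarrow> fin_dim TYPE('v) \<and> group_action G UNIV \<rho> \<and>
     (\<forall>g\<in>carrier G. linear (\<rho> g)) \<and>
     smooth_map (prod_mfd (mfd G) vec_mfd) vec_mfd (\<lambda>(g, v). \<rho> g v)"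

text \<open>The induced left action on the dual, \<open>\<langle>g \<cdot> \<alpha>, v\<rangle> = \<langle>\<alpha>, g\<inverse> \<cdot> v\<rangle>\<close>.\<close>

definition dual_act ::
  "('g, 'e) lie_struct \<Rightarrow> ('g \<Rightarrow> 'v::real_normed_vector \<Rightarrow> 'v) \<Rightarrow> 'g \<Rightarrow> ('v \<Rightarrow>\<^sub>L real) \<Rightarrow> ('v \<Rightarrow>\<^sub>L real)" where
  "dual_act G \<rho> g \<alpha> = \<alpha> o\<^sub>L Blinfun (\<rho> (inv\<^bsub>G\<^esub> g))"

definition inf_act ::
  "('g, 'e::real_normed_vector) lie_struct \<Rightarrow> ('g \<Rightarrow> 'v::real_normed_vector \<Rightarrow> 'v) \<Rightarrow> 'e \<Rightarrow> 'v \<Rightarrow> 'v" where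
  "inf_act G \<rho> \<xi> v = right_deriv G (\<lambda>g. \<rho> g v) \<one>\<^bsub>G\<^esub> \<xi>"

text \<open>\<open>\<langle>v \<diamondop> \<alpha>, \<xi>\<rangle> = \<langle>\<xi> \<cdot> v, \<alpha>\<rangle>\<close>.\<close>

definition diamond ::
  "('g, 'e::real_normed_vector) lie_struct \<Rightarrow> ('g \<Rightarrow> 'v::real_normed_vector \<Rightarrow> 'v) \<Rightarrow>
    'v \<Rightarrow> ('v \<Rightarrow>\<^sub>L real) \<Rightarrow> ('e \<Rightarrow>\<^sub>L real)" where
  "diamond G \<rho> v \<alpha> = Blinfun (\<lambda>\<xi>. blinfun_apply \<alpha> (inf_act G \<rho> \<xi> v))"

definition semidirect ::
  "('g, 'e) lie_struct \<Rightarrow> ('g \<Rightarrow> 'v::real_normed_vector \<Rightarrow> 'v) \<Rightarrow> ('g \<times> 'v) monoid" where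
  "semidirect G \<rho> =
     \<lparr>carrier = carrier G \<times> UNIV,
      mult = (\<lambda>(g, u) (h, v). (g \<otimes>\<^bsub>G\<^esub> h, \<rho> g v + u)),
      one = (\<one>\<^bsub>G\<^esub>, 0)\<rparr>"

text \<open>\<open>coadjoint\<close> is the dual of the adjoint action without an inverse, hence a right action; the
  coadjoint orbits are unaffected by this convention.\<close>

definition coadjoint ::
  "('g, 'e::real_normed_vector) lie_struct \<Rightarrow> ('g \<Rightarrow> 'v::real_normed_vector \<Rightarrow> 'v) \<Rightarrow> 'g \<times> 'v \<Rightarrow>
    ('e \<Rightarrow>\<^sub>L real) \<times> ('v \<Rightarrow>\<^sub>L real) \<Rightarrow> ('e \<Rightarrow>\<^sub>L real) \<times> ('v \<Rightarrow>\<^sub>L real)" where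
  "coadjoint G \<rho> = (\<lambda>(g, u) (\<mu>, \<alpha>).
     (Ad_star G g (\<mu> - diamond G \<rho> u \<alpha>), dual_act G \<rho> (inv\<^bsub>G\<^esub> g) \<alpha>))"

definition coadjoint_orbit ::
  "('g, 'e::real_normed_vector) lie_struct \<Rightarrow> ('g \<Rightarrow> 'v::real_normed_vector \<Rightarrow> 'v) \<Rightarrow>
    ('e \<Rightarrow>\<^sub>L real) \<times> ('v \<Rightarrow>\<^sub>L real) \<Rightarrow> (('e \<Rightarrow>\<^sub>L real) \<times> ('v \<Rightarrow>\<^sub>L real)) set" where
  "coadjoint_orbit G \<rho> = orbit (semidirect G \<rho>) (coadjoint G \<rho>)"

lemma coadjoint_orbit_eq:
  "coadjoint_orbit G \<rho> (\<mu>, \<alpha>) =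
     {(Ad_star G g (\<mu> - diamond G \<rho> u \<alpha>), dual_act G \<rho> (inv\<^bsub>G\<^esub> g) \<alpha>) | g u. g \<in> carrier G}"
  by (force simp: coadjoint_orbit_def orbit_def semidirect_def coadjoint_def)

text \<open>Casimirs are, by convention, the functions that are constant on coadjoint orbits.\<close>

definition casimir ::
  "('g, 'e::real_normed_vector) lie_struct \<Rightarrow> ('g \<Rightarrow> 'v::real_normed_vector \<Rightarrow> 'v) \<Rightarrow>
    (('e \<Rightarrow>\<^sub>L real) \<times> ('v \<Rightarrow>\<^sub>L real) \<Rightarrow> real) \<Rightarrow> bool" where
  "casimir G \<rho> C \<longleftrightarrow> (\<forall>x. \<forall>y\<in>coadjoint_orbit G \<rho> x. C y = C x)"


section \<open>Reduced Hamiltonians and their derivatives\<close>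

text \<open>
  A reduced Hamiltonian lives on the product of the dual Lie algebra and the orbit of \<open>a0\<close>, an
  immersed submanifold; its values elsewhere are irrelevant. If the orbit is not embedded and closed,
  a smooth function on it may fail to extend globally, so an extension only has to agree with \<open>h\<close>
  near the point at hand, nearness on the orbit being that of \<open>G\<close> modulo the isotropy group. A global
  smooth extension is an extension at every point.
\<close>

definition smooth_extension_at ::
  "('g, 'e::real_normed_vector) lie_struct \<Rightarrow> ('g \<Rightarrow> 'v::real_normed_vector \<Rightarrow> 'v) \<Rightarrow>
    (('e \<Rightarrow>\<^sub>L real) \<times> ('v \<Rightarrow>\<^sub>L real) \<Rightarrow> real) \<Rightarrow> ('e \<Rightarrow>\<^sub>L real) \<times> ('v \<Rightarrow>\<^sub>L real) \<Rightarrow>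
    (('e \<Rightarrow>\<^sub>L real) \<times> ('v \<Rightarrow>\<^sub>L real) \<Rightarrow> real) \<Rightarrow> bool" where
  "smooth_extension_at G \<rho> h = (\<lambda>(\<mu>, \<alpha>) H. smooth_on UNIV H \<and>
     (\<exists>U W. open U \<and> \<mu> \<in> U \<and> openin (fst (mfd G)) W \<and> \<one>\<^bsub>G\<^esub> \<in> W \<and>
        (\<forall>\<nu>\<in>U. \<forall>g\<in>W. H (\<nu>, dual_act G \<rho> g \<alpha>) = h (\<nu>, dual_act G \<rho> g \<alpha>))))"

definition smooth_reduced ::
  "('g, 'e::real_normed_vector) lie_struct \<Rightarrow> ('g \<Rightarrow> 'v::real_normed_vector \<Rightarrow> 'v) \<Rightarrow> ('v \<Rightarrow>\<^sub>L real) \<Rightarrow>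
    (('e \<Rightarrow>\<^sub>L real) \<times> ('v \<Rightarrow>\<^sub>L real) \<Rightarrow> real) \<Rightarrow> bool" where
  "smooth_reduced G \<rho> a0 h \<longleftrightarrow>
     (\<forall>x \<in> UNIV \<times> orbit G (dual_act G \<rho>) a0. \<exists>H. smooth_extension_at G \<rho> h x H)"

text \<open>The partial derivatives are elements of the Lie algebra and of \<open>V\<close>, via the canonical
  isomorphism with the bidual. The second one depends on the choice of an extension and is
  therefore a relation.\<close>

definition deriv_mu ::
  "(('e::real_normed_vector \<Rightarrow>\<^sub>L real) \<times> ('v::real_normed_vector \<Rightarrow>\<^sub>L real) \<Rightarrow> real) \<Rightarrow>
    ('e \<Rightarrow>\<^sub>L real) \<times> ('v \<Rightarrow>\<^sub>L real) \<Rightarrow> 'e \<Rightarrow> bool" where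
  "deriv_mu h = (\<lambda>(\<mu>, \<alpha>) \<xi>.
     ((\<lambda>\<nu>. h (\<nu>, \<alpha>)) has_derivative (\<lambda>\<delta>. blinfun_apply \<delta> \<xi>)) (at \<mu>))"

definition deriv_alpha ::
  "('g, 'e::real_normed_vector) lie_struct \<Rightarrow> ('g \<Rightarrow> 'v::real_normed_vector \<Rightarrow> 'v) \<Rightarrow>
    (('e \<Rightarrow>\<^sub>L real) \<times> ('v \<Rightarrow>\<^sub>L real) \<Rightarrow> real) \<Rightarrow> ('e \<Rightarrow>\<^sub>L real) \<times> ('v \<Rightarrow>\<^sub>L real) \<Rightarrow> 'v \<Rightarrow> bool" where
  "deriv_alpha G \<rho> h = (\<lambda>(\<mu>, \<alpha>) v. \<exists>H. smooth_extension_at G \<rho> h (\<mu>, \<alpha>) H \<and>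
     ((\<lambda>\<beta>. H (\<mu>, \<beta>)) has_derivative (\<lambda>\<delta>. blinfun_apply \<delta> v)) (at \<alpha>))"


section \<open>Retraction maps\<close>

text \<open>\<open>D\<close> is the neighbourhood of 0 on which \<open>\<tau>\<close> is a diffeomorphism onto an open set; the inverse of
  \<open>\<tau>\<close> always means \<open>inv_into D \<tau>\<close>, with domain \<open>\<tau> ` D\<close>.\<close>

definition lie_retraction ::
  "('g, 'e::real_normed_vector) lie_struct \<Rightarrow> ('e \<Rightarrow> 'g) \<Rightarrow> 'e set \<Rightarrow> bool" where
  "lie_retraction G \<tau> D \<longleftrightarrow> range \<tau> \<subseteq> carrier G \<and> \<tau> 0 = \<one>\<^bsub>G\<^esub> \<and> open D \<and> 0 \<in> D \<and>
     openin (fst (mfd G)) (\<tau> ` D) \<and> inj_on \<tau> D \<and>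
     diffeomorphism (open_submfd vec_mfd D) (open_submfd (mfd G) (\<tau> ` D)) \<tau> (inv_into D \<tau>)"

definition dtau_inv ::
  "('g, 'e::real_normed_vector) lie_struct \<Rightarrow> ('e \<Rightarrow> 'g) \<Rightarrow> 'e set \<Rightarrow> 'e \<Rightarrow> 'e \<Rightarrow> 'e" where
  "dtau_inv G \<tau> D \<xi> \<eta> = right_deriv G (inv_into D \<tau>) (\<tau> \<xi>) \<eta>"

definition dtau_inv_star ::
  "('g, 'e::real_normed_vector) lie_struct \<Rightarrow> ('e \<Rightarrow> 'g) \<Rightarrow> 'e set \<Rightarrow> 'e \<Rightarrow> ('e \<Rightarrow>\<^sub>L real) \<Rightarrow> ('e \<Rightarrow>\<^sub>L real)" where
  "dtau_inv_star G \<tau> D \<xi> \<mu> = \<mu> o\<^sub>L Blinfun (dtau_inv G \<tau> D \<xi>)"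


section \<open>Wiener processes\<close>

definition wiener_process :: "'w measure \<Rightarrow> (real \<Rightarrow> 'w \<Rightarrow> real) \<Rightarrow> bool" where
  "wiener_process P W \<longleftrightarrow>
     (\<forall>t\<ge>0. W t \<in> borel_measurable P) \<and>
     (AE \<omega> in P. W 0 \<omega> = 0) \<and>
     (AE \<omega> in P. continuous_on {0..} (\<lambda>t. W t \<omega>)) \<and>
     (\<forall>s\<ge>0. \<forall>t>s. distributed P lborel (\<lambda>\<omega>. W t \<omega> - W s \<omega>) (normal_density 0 (sqrt (t - s)))) \<and>
     (\<forall>(t::nat \<Rightarrow> real) n. 0 \<le> t 0 \<longrightarrow> mono t \<longrightarrow>
        prob_space.indep_vars P (\<lambda>_. borel) (\<lambda>j \<omega>. W (t (Suc j)) \<omega> - W (t j) \<omega>) {..<n})"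

definition independent_wiener_processes ::
  "'w measure \<Rightarrow> nat \<Rightarrow> (nat \<Rightarrow> real \<Rightarrow> 'w \<Rightarrow> real) \<Rightarrow> bool" where
  "independent_wiener_processes P N W \<longleftrightarrow> prob_space P \<and>
     (\<forall>i\<in>{1..N}. wiener_process P (W i)) \<and>
     prob_space.indep_vars P (\<lambda>_. PiM {0..} (\<lambda>_. borel)) (\<lambda>i \<omega>. \<lambda>t\<in>{0..}. W i t \<omega>) {1..N}"


section \<open>The integrator\<close>

text \<open>\<open>\<Delta>W i k\<close> is the increment of the \<open>i\<close>-th noise over the \<open>k\<close>-th step.\<close>

definition step_hamiltonian ::
  "('x \<Rightarrow> real) \<Rightarrow> (nat \<Rightarrow> 'x \<Rightarrow> real) \<Rightarrow> nat \<Rightarrow> real \<Rightarrow> (nat \<Rightarrow> nat \<Rightarrow> real) \<Rightarrow> nat \<Rightarrow> 'x \<Rightarrow> real" where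
  "step_hamiltonian h hs N \<Delta>t \<Delta>W k x = h x + (\<Sum>i=1..N. hs i x * (\<Delta>W i k / \<Delta>t))"

text \<open>With \<open>g\<close> and \<open>g'\<close> the sequences of nodes and midpoints, the following are the two discrete
  velocities of the \<open>k\<close>-th step, on its second and first half, respectively.\<close>

definition xi ::
  "('g, 'e::real_normed_vector) lie_struct \<Rightarrow> ('e \<Rightarrow> 'g) \<Rightarrow> 'e set \<Rightarrow> real \<Rightarrow>
    (nat \<Rightarrow> 'g) \<Rightarrow> (nat \<Rightarrow> 'g) \<Rightarrow> nat \<Rightarrow> 'e" where
  "xi G \<tau> D \<Delta>t g g' k = (1 / \<Delta>t) *\<^sub>R inv_into D \<tau> (inv\<^bsub>G\<^esub> (g' k) \<otimes>\<^bsub>G\<^esub> g k)"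

definition xi' ::
  "('g, 'e::real_normed_vector) lie_struct \<Rightarrow> ('e \<Rightarrow> 'g) \<Rightarrow> 'e set \<Rightarrow> real \<Rightarrow>
    (nat \<Rightarrow> 'g) \<Rightarrow> (nat \<Rightarrow> 'g) \<Rightarrow> nat \<Rightarrow> 'e" where
  "xi' G \<tau> D \<Delta>t g g' k = (1 / \<Delta>t) *\<^sub>R inv_into D \<tau> (inv\<^bsub>G\<^esub> (g (k - 1)) \<otimes>\<^bsub>G\<^esub> g' k)"

definition advected ::
  "('g, 'e) lie_struct \<Rightarrow> ('g \<Rightarrow> 'v::real_normed_vector \<Rightarrow> 'v) \<Rightarrow> ('v \<Rightarrow>\<^sub>L real) \<Rightarrow>
    (nat \<Rightarrow> 'g) \<Rightarrow> nat \<Rightarrow> ('v \<Rightarrow>\<^sub>L real)" where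
  "advected G \<rho> a0 g k = dual_act G \<rho> (inv\<^bsub>G\<^esub> (g k)) a0"

text \<open>\<open>H k\<close> is the Hamiltonian of the \<open>k\<close>-th step, and \<open>m1\<close>, \<open>m2\<close> are the internal momenta.\<close>

definition midpoint_integrator ::
  "('g, 'e::real_normed_vector) lie_struct \<Rightarrow> ('g \<Rightarrow> 'v::real_normed_vector \<Rightarrow> 'v) \<Rightarrow>
    ('e \<Rightarrow> 'g) \<Rightarrow> 'e set \<Rightarrow> ('v \<Rightarrow>\<^sub>L real) \<Rightarrow>
    (nat \<Rightarrow> ('e \<Rightarrow>\<^sub>L real) \<times> ('v \<Rightarrow>\<^sub>L real) \<Rightarrow> real) \<Rightarrow> real \<Rightarrow> nat \<Rightarrow>
    (nat \<Rightarrow> 'g) \<Rightarrow> (nat \<Rightarrow> 'g) \<Rightarrow> (nat \<Rightarrow> 'e \<Rightarrow>\<^sub>L real) \<Rightarrow> (nat \<Rightarrow> 'e \<Rightarrow>\<^sub>L real) \<Rightarrow> bool" where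
  "midpoint_integrator G \<rho> \<tau> D a0 H \<Delta>t M g g' m1 m2 \<longleftrightarrow>
     (\<forall>k\<in>{0..M}. g k \<in> carrier G) \<and> (\<forall>k\<in>{1..M}. g' k \<in> carrier G) \<and>
     (\<forall>k\<in>{1..M}. inv\<^bsub>G\<^esub> (g' k) \<otimes>\<^bsub>G\<^esub> g k \<in> \<tau> ` D \<and> inv\<^bsub>G\<^esub> (g (k - 1)) \<otimes>\<^bsub>G\<^esub> g' k \<in> \<tau> ` D) \<and>
     (let \<xi> = xi G \<tau> D \<Delta>t g g'; \<xi>' = xi' G \<tau> D \<Delta>t g g'; \<alpha>' = advected G \<rho> a0 g' in
       (\<forall>k\<in>{1..M}. \<exists>d\<mu> d\<alpha>.
          deriv_mu (H k) ((1 / 2) *\<^sub>R (m1 k + m2 k), \<alpha>' k) d\<mu> \<and>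
          deriv_alpha G \<rho> (H k) ((1 / 2) *\<^sub>R (m1 k + m2 k), \<alpha>' k) d\<alpha> \<and>
          (1 / \<Delta>t) *\<^sub>R
            (Ad_star G (\<tau> (\<Delta>t *\<^sub>R \<xi>' k)) (dtau_inv_star G \<tau> D (\<Delta>t *\<^sub>R \<xi>' k) (m1 k))
              - dtau_inv_star G \<tau> D (\<Delta>t *\<^sub>R \<xi> k) (m2 k))
            = diamond G \<rho> d\<alpha> (\<alpha>' k) \<and>
          \<xi>' k = \<xi> k \<and> \<xi> k = (1 / 2) *\<^sub>R d\<mu>) \<and>
       (\<forall>k\<in>{1..<M}.
          Ad_star G (\<tau> (\<Delta>t *\<^sub>R \<xi> k)) (dtau_inv_star G \<tau> D (\<Delta>t *\<^sub>R \<xi> k) (m2 k))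
            = dtau_inv_star G \<tau> D (\<Delta>t *\<^sub>R \<xi>' (k + 1)) (m1 (k + 1))))"

text \<open>The two formulas agree where both apply, by the last equation of the scheme.\<close>

definition trivialized_momenta ::
  "('g, 'e::real_normed_vector) lie_struct \<Rightarrow> ('e \<Rightarrow> 'g) \<Rightarrow> 'e set \<Rightarrow> real \<Rightarrow> nat \<Rightarrow>
    (nat \<Rightarrow> 'g) \<Rightarrow> (nat \<Rightarrow> 'g) \<Rightarrow> (nat \<Rightarrow> 'e \<Rightarrow>\<^sub>L real) \<Rightarrow> (nat \<Rightarrow> 'e \<Rightarrow>\<^sub>L real) \<Rightarrow>
    (nat \<Rightarrow> 'e \<Rightarrow>\<^sub>L real) \<Rightarrow> bool" where
  "trivialized_momenta G \<tau> D \<Delta>t M g g' m1 m2 \<mu> \<longleftrightarrow>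
     (let \<xi> = xi G \<tau> D \<Delta>t g g'; \<xi>' = xi' G \<tau> D \<Delta>t g g' in
       (\<forall>k\<in>{0..<M}. \<mu> k = dtau_inv_star G \<tau> D (\<Delta>t *\<^sub>R \<xi>' (k + 1)) (m1 (k + 1))) \<and>
       (\<forall>k\<in>{1..M}. \<mu> k = Ad_star G (\<tau> (\<Delta>t *\<^sub>R \<xi> k)) (dtau_inv_star G \<tau> D (\<Delta>t *\<^sub>R \<xi> k) (m2 k))))"

end

theory Submission
  imports Defs
begin

text \<open>
  One step of the integrator is the composite of two coadjoint transformations. Put
  \<open>p = g\<^sub>k\<^sub>-\<^sub>1\<inverse> g'\<^sub>k\<close> and \<open>q = g'\<^sub>k\<inverse> g\<^sub>k\<close>, and let \<open>n\<close> be the second internal momentum pulled back by the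
  derivative of the inverse retraction. As \<open>p\<close> and \<open>q\<close> are the values of the retraction at the two
  discrete displacements, the scheme and the definition of the trivialized momenta say that
  \<open>Ad\<^sup>*\<^sub>p \<mu>\<^sub>k\<^sub>-\<^sub>1 - n = (\<Delta>t d) \<diamondop> \<alpha>'\<^sub>k\<close> and \<open>\<mu>\<^sub>k = Ad\<^sup>*\<^sub>q n\<close>, with \<open>d\<close> a derivative of the Hamiltonian, while
  \<open>\<alpha>'\<^sub>k = p\<inverse> \<cdot> \<alpha>\<^sub>k\<^sub>-\<^sub>1\<close> and \<open>\<alpha>\<^sub>k = q\<inverse> \<cdot> \<alpha>'\<^sub>k\<close>. Hence \<open>(p, 0)\<close> takes \<open>(\<mu>\<^sub>k\<^sub>-\<^sub>1, \<alpha>\<^sub>k\<^sub>-\<^sub>1)\<close> to the point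
  \<open>(Ad\<^sup>*\<^sub>p \<mu>\<^sub>k\<^sub>-\<^sub>1, \<alpha>'\<^sub>k)\<close>, and \<open>(q, \<Delta>t d)\<close> takes this point to \<open>(\<mu>\<^sub>k, \<alpha>\<^sub>k)\<close> (\<open>integrator_step\<close>). The
  Hamiltonian and the noise enter through the translation vector \<open>\<Delta>t d\<close> and through \<open>p\<close> and \<open>q\<close>: they
  decide how the orbit is traversed, not which orbit it is.

  It remains to see that coadjoint transformations compose (\<open>coadjoint_mult\<close>). Collecting the two
  translations into one uses \<open>Ad\<^sup>*\<^sub>g ((g \<cdot> v) \<diamondop> \<alpha>) = v \<diamondop> (g\<inverse> \<cdot> \<alpha>)\<close>, which is dual to the equivariance
  \<open>(Ad\<^sub>g \<xi>) \<cdot> (g \<cdot> v) = g \<cdot> (\<xi> \<cdot> v)\<close> of the infinitesimal action. This equivariance, as well as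
  \<open>Ad\<^sub>g\<^sub>h = Ad\<^sub>g Ad\<^sub>h\<close>, is the chain rule for a function composed with a conjugation, differentiated at
  the identity (\<open>has_derivative_conj\<close>). The chain rule needs differentiability in charts, which is
  extracted from the smoothness of the multiplication and of the representation.
\<close>

section \<open>Derivatives of smooth maps in charts\<close>

lemma has_derivative_transform_nhds:
  assumes "(f has_derivative f') (at x)" and "eventually (\<lambda>y. f y = g y) (nhds x)"
  shows "(g has_derivative f') (at x)"
proof (rule has_derivative_transform_eventually[OF assms(1)])
  show "f x = g x" using eventually_nhds_x_imp_x[OF assms(2)] .
  show "eventually (\<lambda>y. f y = g y) (at x)"
    using assms(2) by (simp add: eventually_at_filter eventually_mono)
qed simp

lemma differentiable_transform_eventually:
  assumes "f differentiable (at x)" and "eventually (\<lambda>y. f y = g y) (nhds x)"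
  shows "g differentiable (at x)"
  using assms has_derivative_transform_nhds unfolding differentiable_def by blast

lemma inv_into_map_prod:
  assumes "inj_on f A" and "inj_on g B" and "x \<in> f ` A" and "y \<in> g ` B"
  shows "inv_into (A \<times> B) (map_prod f g) (x, y) = (inv_into A f x, inv_into B g y)"
proof (rule inv_into_f_eq)
  show "inj_on (map_prod f g) (A \<times> B)" using assms by (simp add: map_prod_inj_on)
qed (use assms in \<open>auto simp: inv_into_into f_inv_into_f\<close>)

lemma smooth_on_imp_differentiable:
  assumes "smooth_on S f" and "x \<in> S"
  shows "f differentiable (at x)"
proof -
  have "Ck_on (Suc 0) S f" using assms(1) unfolding smooth_on_def by blast
  then show ?thesis using assms(2) by simp
qed

lemma smooth_map_chart:
  assumes "smooth_map M N F" and "(U, \<phi>) \<in> snd M" and "(V, \<psi>) \<in> snd N"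
  shows "smooth_on (\<phi> ` {p \<in> U. F p \<in> V}) (\<psi> \<circ> F \<circ> inv_into U \<phi>)"
  using assms by (cases M; cases N) (auto simp: smooth_map_def dest!: bspec)

text \<open>The charts of a product manifold have the inverse of a product map as parametrization, while
  partial derivatives need the two parametrizations separately. They agree only on the image of the
  chart, which is a neighbourhood of the point as it is open.\<close>
lemma smooth_map_prod_differentiable:
  assumes F: "smooth_map (prod_mfd M M') N (\<lambda>(p, q). F p q)"
    and charts: "(U, \<phi>) \<in> snd M" "(V, \<psi>) \<in> snd M'" "(W, \<theta>) \<in> snd N"
    and inj: "inj_on \<phi> U" "inj_on \<psi> V" and opn: "open (\<phi> ` U)" "open (\<psi> ` V)"
    and mem: "p \<in> U" "q \<in> V" "F p q \<in> W"
  shows "(\<lambda>(x, y). \<theta> (F (inv_into U \<phi> x) (inv_into V \<psi> y))) differentiable (at (\<phi> p, \<psi> q))"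
proof -
  let ?F = "\<lambda>(p, q). F p q"
  let ?f = "\<theta> \<circ> ?F \<circ> inv_into (U \<times> V) (map_prod \<phi> \<psi>)"
  have "(U \<times> V, map_prod \<phi> \<psi>) \<in> snd (prod_mfd M M')"
    using charts by (cases M; cases M') (auto simp: prod_mfd_def)
  from smooth_map_chart[OF F this charts(3)]
  have "smooth_on (map_prod \<phi> \<psi> ` {z \<in> U \<times> V. ?F z \<in> W}) ?f" .
  moreover have "(\<phi> p, \<psi> q) \<in> map_prod \<phi> \<psi> ` {z \<in> U \<times> V. ?F z \<in> W}"
    using mem by force
  ultimately have "?f differentiable (at (\<phi> p, \<psi> q))" by (rule smooth_on_imp_differentiable)
  moreover have "eventually (\<lambda>z. z \<in> \<phi> ` U \<times> \<psi> ` V) (nhds (\<phi> p, \<psi> q))"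
    using opn mem by (intro eventually_nhds_in_open open_Times) auto
  then have "eventually (\<lambda>z. ?f z = (\<lambda>(x, y). \<theta> (F (inv_into U \<phi> x) (inv_into V \<psi> y))) z)
      (nhds (\<phi> p, \<psi> q))"
    by eventually_elim (auto simp: inv_into_map_prod[OF inj])
  ultimately show ?thesis by (rule differentiable_transform_eventually)
qed

lemma smooth_map_fst_differentiable:
  assumes F: "smooth_map (prod_mfd M M') N (\<lambda>(p, q). F p q)"
    and charts: "(U, \<phi>) \<in> snd M" "(V, \<psi>) \<in> snd M'" "(W, \<theta>) \<in> snd N"
    and inj: "inj_on \<phi> U" "inj_on \<psi> V" and opn: "open (\<phi> ` U)" "open (\<psi> ` V)"
    and mem: "p \<in> U" "q \<in> V" "F p q \<in> W"
  shows "(\<lambda>x. \<theta> (F (inv_into U \<phi> x) q)) differentiable (at (\<phi> p))"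
proof -
  have "(\<lambda>x. (x, \<psi> q)) differentiable (at (\<phi> p))"
    unfolding differentiable_def by (auto intro!: derivative_eq_intros)
  from differentiable_chain_at[OF this smooth_map_prod_differentiable[OF assms]]
  show ?thesis using inj mem by (simp add: o_def)
qed

lemma smooth_map_snd_differentiable:
  assumes F: "smooth_map (prod_mfd M M') N (\<lambda>(p, q). F p q)"
    and charts: "(U, \<phi>) \<in> snd M" "(V, \<psi>) \<in> snd M'" "(W, \<theta>) \<in> snd N"
    and inj: "inj_on \<phi> U" "inj_on \<psi> V" and opn: "open (\<phi> ` U)" "open (\<psi> ` V)"
    and mem: "p \<in> U" "q \<in> V" "F p q \<in> W"
  shows "(\<lambda>y. \<theta> (F p (inv_into V \<psi> y))) differentiable (at (\<psi> q))"
proof -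
  have "(\<lambda>y. (\<phi> p, y)) differentiable (at (\<psi> q))"
    unfolding differentiable_def by (auto intro!: derivative_eq_intros)
  from differentiable_chain_at[OF this smooth_map_prod_differentiable[OF assms]]
  show ?thesis using inj mem by (simp add: o_def)
qed

lemma smooth_map_prod_continuous:
  assumes "smooth_map (prod_mfd M M') N F"
  shows "continuous_map (prod_topology (fst M) (fst M')) (fst N) F"
  using assms by (cases M; cases M'; cases N) (simp add: smooth_map_def prod_mfd_def)

lemma vec_chart: "(UNIV, id) \<in> snd vec_mfd"
  by (simp add: vec_mfd_def)

text \<open>A linear map that is continuous at 0 is bounded, by scaling. The continuity of the group elements of
  a representation comes from their smoothness, hence this form of the hypothesis.\<close>
lemma linear_differentiable_imp_bounded_linear:
  assumes "linear f" and "f differentiable (at 0)"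
  shows "bounded_linear f"
proof -
  have "isCont f 0" using assms(2) by (rule differentiable_imp_continuous_within)
  then obtain d where d: "d > 0" "\<And>x. norm x < d \<Longrightarrow> norm (f x) < 1"
    unfolding continuous_at_eps_delta dist_norm
    by (metis diff_zero linear_0[OF assms(1)] zero_less_one)
  have "norm (f x) \<le> norm x * (2 / d)" for x
  proof (cases "x = 0")
    case False
    let ?c = "d / (2 * norm x)"
    have "norm (?c *\<^sub>R x) < d" using d(1) False by simp
    from d(2)[OF this] have "?c * norm (f x) < 1"
      using d(1) by (simp add: linear_scale[OF assms(1)] abs_mult)
    then show ?thesis using d(1) False by (simp add: field_simps)
  qed (simp add: linear_0[OF assms(1)])
  then show ?thesis
    using assms(1) by (intro bounded_linear_intro[where K = "2 / d"])
      (auto simp: linear_add linear_scale)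
qed

section \<open>Charts and translations of a Lie group\<close>

context lie_group
begin

lemma atlas_chart:
  assumes "(U, \<phi>) \<in> snd (mfd G)"
  shows "openin (fst (mfd G)) U" and "open (\<phi> ` U)" and "inj_on \<phi> U" and "U \<subseteq> carrier G"
    and "homeomorphic_map (subtopology (fst (mfd G)) U) (top_of_set (\<phi> ` U)) \<phi>"
proof -
  have "is_chart (fst (mfd G)) (U, \<phi>)"
    using manifold assms by (auto simp: smooth_manifold_def split: prod.splits)
  then show 1: "openin (fst (mfd G)) U" and "open (\<phi> ` U)"
    and 2: "homeomorphic_map (subtopology (fst (mfd G)) U) (top_of_set (\<phi> ` U)) \<phi>"
    by (auto simp: is_chart_def)
  show 3: "U \<subseteq> carrier G" using openin_subset[OF 1] topspace_eq by simp
  show "inj_on \<phi> U"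
    using homeomorphic_imp_injective_map[OF 2] 3 by (simp add: topspace_eq Int_absorb1)
qed

lemma chart_exists:
  assumes "g \<in> carrier G"
  obtains U \<phi> where "(U, \<phi>) \<in> snd (mfd G)" and "g \<in> U"
proof -
  have "(\<Union>c\<in>snd (mfd G). fst c) = carrier G"
    using manifold topspace_eq by (auto simp: smooth_manifold_def split: prod.splits)
  then show ?thesis using assms that by (metis UN_E prod.collapse)
qed

text \<open>Parametrizations are continuous. In this form the fact allows a parametrized point near \<open>p\<close> to be
  assumed in the domain of any other chart around \<open>p\<close>.\<close>
lemma eventually_inv_chart_in:
  assumes "(U, \<phi>) \<in> snd (mfd G)" and "p \<in> U" and "openin (fst (mfd G)) W" and "p \<in> W"
  shows "eventually (\<lambda>x. inv_into U \<phi> x \<in> W) (nhds (\<phi> p))"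
proof -
  note chart = atlas_chart[OF assms(1)]
  have "openin (subtopology (fst (mfd G)) U) (U \<inter> W)"
    using assms(3) by (metis inf_commute openin_subtopology_Int)
  then have "openin (top_of_set (\<phi> ` U)) (\<phi> ` (U \<inter> W))"
    using homeomorphic_imp_open_map[OF chart(5)] by (auto simp: open_map_def)
  then have "open (\<phi> ` (U \<inter> W))" using chart(2) openin_open_trans by blast
  then have "eventually (\<lambda>x. x \<in> \<phi> ` (U \<inter> W)) (nhds (\<phi> p))"
    using assms by (intro eventually_nhds_in_open) auto
  then show ?thesis by eventually_elim (use chart(3) in auto)
qed

lemma e_chart_pair: "(fst (e_chart G), e_coord G) \<in> snd (mfd G)"
  using e_chart_in_atlas by (simp add: e_coord_def)

lemma e_param_eq: "e_param G = inv_into (fst (e_chart G)) (e_coord G)"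
  by (simp add: e_param_def e_coord_def)

lemma eventually_e_param_in:
  assumes "openin (fst (mfd G)) W" and "\<one> \<in> W"
  shows "eventually (\<lambda>x. e_param G x \<in> W) (nhds (e_coord G \<one>))"
  unfolding e_param_eq using e_chart_pair e_chart_at_one assms by (rule eventually_inv_chart_in)

lemma eventually_e_param_carrier:
  "eventually (\<lambda>x. e_param G x \<in> carrier G) (nhds (e_coord G \<one>))"
  using eventually_e_param_in[of "carrier G"] openin_topspace topspace_eq by (metis one_closed)

lemma e_param_e_coord: "g \<in> fst (e_chart G) \<Longrightarrow> e_param G (e_coord G g) = g"
  unfolding e_param_eq using atlas_chart(3)[OF e_chart_pair] by simp

lemma eventually_e_coord_e_param: "eventually (\<lambda>x. e_coord G (e_param G x) = x) (nhds (e_coord G \<one>))"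
proof -
  have "eventually (\<lambda>x. x \<in> e_coord G ` fst (e_chart G)) (nhds (e_coord G \<one>))"
    using atlas_chart(2)[OF e_chart_pair] e_chart_at_one by (intro eventually_nhds_in_open) auto
  then show ?thesis unfolding e_param_eq by eventually_elim (rule f_inv_into_f)
qed

text \<open>The right translation by the identity that occurs in \<open>right_deriv\<close> can be dropped because the
  parametrization takes its values in the group, though only near the base point.\<close>
lemma right_deriv_one:
  assumes "((\<lambda>x. F (e_param G x)) has_derivative F') (at (e_coord G \<one>))"
  shows "right_deriv G F \<one> = F'"
proof
  fix \<eta>
  have "eventually (\<lambda>x. F (e_param G x) = F (e_param G x \<otimes> \<one>)) (nhds (e_coord G \<one>))"
    using eventually_e_param_carrier by eventually_elim simp
  with assms have "((\<lambda>x. F (e_param G x \<otimes> \<one>)) has_derivative F') (at (e_coord G \<one>))"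
    by (rule has_derivative_transform_nhds)
  then show "right_deriv G F \<one> \<eta> = F' \<eta>"
    unfolding right_deriv_def by (simp add: frechet_derivative_at[symmetric])
qed

lemma right_deriv_one_has_derivative:
  assumes "(\<lambda>x. F (e_param G x)) differentiable (at (e_coord G \<one>))"
  shows "((\<lambda>x. F (e_param G x)) has_derivative right_deriv G F \<one>) (at (e_coord G \<one>))"
  using assms right_deriv_one unfolding differentiable_def by metis

section \<open>The adjoint action\<close>

lemma openin_left_translate:
  assumes "g \<in> carrier G" and "openin (fst (mfd G)) W"
  shows "openin (fst (mfd G)) {x \<in> carrier G. g \<otimes> x \<in> W}"
proof -
  have "continuous_map (fst (mfd G)) (fst (mfd G)) ((\<lambda>(g, h). g \<otimes> h) \<circ> (\<lambda>x. (g, x)))"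
    using assms(1) topspace_eq
    by (intro continuous_map_compose[OF _ smooth_map_prod_continuous[OF smooth_mult]]
          continuous_map_pairedI) auto
  from openin_continuous_map_preimage[OF this assms(2)] show ?thesis by (simp add: topspace_eq)
qed

lemma openin_right_translate:
  assumes "g \<in> carrier G" and "openin (fst (mfd G)) W"
  shows "openin (fst (mfd G)) {x \<in> carrier G. x \<otimes> g \<in> W}"
proof -
  have "continuous_map (fst (mfd G)) (fst (mfd G)) ((\<lambda>(g, h). g \<otimes> h) \<circ> (\<lambda>x. (x, g)))"
    using assms(1) topspace_eq
    by (intro continuous_map_compose[OF _ smooth_map_prod_continuous[OF smooth_mult]]
          continuous_map_pairedI) auto
  from openin_continuous_map_preimage[OF this assms(2)] show ?thesis by (simp add: topspace_eq)
qed

lemma openin_conj: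
  assumes "g \<in> carrier G" and "openin (fst (mfd G)) W"
  shows "openin (fst (mfd G)) {x \<in> carrier G. g \<otimes> x \<otimes> inv g \<in> W}"
proof -
  have "{x \<in> carrier G. g \<otimes> x \<in> {y \<in> carrier G. y \<otimes> inv g \<in> W}} =
      {x \<in> carrier G. g \<otimes> x \<otimes> inv g \<in> W}" using assms(1) by auto
  then show ?thesis
    using openin_left_translate[OF assms(1) openin_right_translate[OF inv_closed[OF assms(1)] assms(2)]]
    by simp
qed

text \<open>Conjugation is the left translation by \<open>g\<close> followed by the right translation by \<open>g\<inverse>\<close>, and each
  is differentiable by the smoothness of the multiplication. The intermediate points lie near \<open>g\<close>,
  so that the chain rule passes through a chart at \<open>g\<close>.\<close>
lemma Ad_has_derivative:
  assumes g: "g \<in> carrier G"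
  shows "((\<lambda>x. e_coord G (g \<otimes> e_param G x \<otimes> inv g)) has_derivative Ad G g) (at (e_coord G \<one>))"
proof -
  obtain V \<psi> where V: "(V, \<psi>) \<in> snd (mfd G)" "g \<in> V" using chart_exists[OF g] .
  obtain V' \<psi>' where V': "(V', \<psi>') \<in> snd (mfd G)" "inv g \<in> V'" using chart_exists[OF inv_closed[OF g]] .
  note cV = atlas_chart[OF V(1)] and cV' = atlas_chart[OF V'(1)] and cE = atlas_chart[OF e_chart_pair]
  have "(\<lambda>x. \<psi> (g \<otimes> e_param G x)) differentiable (at (e_coord G \<one>))"
    unfolding e_param_eq
    by (rule smooth_map_snd_differentiable[OF smooth_mult V(1) e_chart_pair V(1)])
      (use cV cE V e_chart_at_one g in auto)
  moreover have "(\<lambda>y. e_coord G (inv_into V \<psi> y \<otimes> inv g)) differentiable (at (\<psi> (g \<otimes> e_param G (e_coord G \<one>))))"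
  proof -
    have "(\<lambda>y. e_coord G (inv_into V \<psi> y \<otimes> inv g)) differentiable (at (\<psi> g))"
      by (rule smooth_map_fst_differentiable[OF smooth_mult V(1) V'(1) e_chart_pair])
        (use cV cV' V V' e_chart_at_one g in auto)
    then show ?thesis using g e_chart_at_one by (simp add: e_param_e_coord)
  qed
  ultimately have "((\<lambda>y. e_coord G (inv_into V \<psi> y \<otimes> inv g)) \<circ> (\<lambda>x. \<psi> (g \<otimes> e_param G x)))
      differentiable (at (e_coord G \<one>))"
    by (rule differentiable_chain_at)
  moreover have "eventually (\<lambda>x. e_param G x \<in> {x \<in> carrier G. g \<otimes> x \<in> V}) (nhds (e_coord G \<one>))"
    using openin_left_translate[OF g cV(1)] V(2) g by (intro eventually_e_param_in) auto
  then have "eventually (\<lambda>x. ((\<lambda>y. e_coord G (inv_into V \<psi> y \<otimes> inv g)) \<circ> (\<lambda>x. \<psi> (g \<otimes> e_param G x))) x =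
      e_coord G (g \<otimes> e_param G x \<otimes> inv g)) (nhds (e_coord G \<one>))"
    by eventually_elim (simp add: cV(3))
  ultimately have "(\<lambda>x. e_coord G (g \<otimes> e_param G x \<otimes> inv g)) differentiable (at (e_coord G \<one>))"
    by (rule differentiable_transform_eventually)
  from right_deriv_one_has_derivative[OF this] show ?thesis
    by (simp add: Ad_def[abs_def])
qed

lemma bounded_linear_Ad: "g \<in> carrier G \<Longrightarrow> bounded_linear (Ad G g)"
  using Ad_has_derivative has_derivative_bounded_linear by blast

text \<open>The chain rule that carries the algebra of adjoint actions: composition of \<open>F\<close> with a conjugation,
  which fixes the identity, composes the derivative of \<open>F\<close> with the adjoint action.\<close>
lemma has_derivative_conj:
  assumes F: "((\<lambda>x. F (e_param G x)) has_derivative F') (at (e_coord G \<one>))" and g: "g \<in> carrier G"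
  shows "((\<lambda>x. F (g \<otimes> e_param G x \<otimes> inv g)) has_derivative (\<lambda>\<eta>. F' (Ad G g \<eta>))) (at (e_coord G \<one>))"
proof -
  let ?c = "\<lambda>x. e_coord G (g \<otimes> e_param G x \<otimes> inv g)"
  have "?c (e_coord G \<one>) = e_coord G \<one>" using g e_chart_at_one by (simp add: e_param_e_coord)
  then have "(((\<lambda>x. F (e_param G x)) \<circ> ?c) has_derivative (F' \<circ> Ad G g)) (at (e_coord G \<one>))"
    using F by (intro diff_chain_at[OF Ad_has_derivative[OF g]]) simp
  moreover have "eventually (\<lambda>x. ((\<lambda>x. F (e_param G x)) \<circ> ?c) x = F (g \<otimes> e_param G x \<otimes> inv g))
      (nhds (e_coord G \<one>))"
  proof -
    have "eventually (\<lambda>x. e_param G x \<in> {x \<in> carrier G. g \<otimes> x \<otimes> inv g \<in> fst (e_chart G)})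
        (nhds (e_coord G \<one>))"
      using openin_conj[OF g atlas_chart(1)[OF e_chart_pair]] g e_chart_at_one
      by (intro eventually_e_param_in) auto
    then show ?thesis by eventually_elim (simp add: e_param_e_coord)
  qed
  ultimately have "((\<lambda>x. F (g \<otimes> e_param G x \<otimes> inv g)) has_derivative (F' \<circ> Ad G g)) (at (e_coord G \<one>))"
    by (rule has_derivative_transform_nhds)
  then show ?thesis by (simp add: o_def)
qed

text \<open>Conjugation by \<open>g \<otimes> h\<close> is conjugation by \<open>h\<close> followed by conjugation by \<open>g\<close>; differentiate.\<close>
lemma Ad_mult:
  assumes g: "g \<in> carrier G" and h: "h \<in> carrier G"
  shows "Ad G (g \<otimes> h) \<eta> = Ad G g (Ad G h \<eta>)"
proof -
  have ev: "eventually (\<lambda>x. e_coord G (g \<otimes> (h \<otimes> e_param G x \<otimes> inv h) \<otimes> inv g) =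
      e_coord G (g \<otimes> h \<otimes> e_param G x \<otimes> inv (g \<otimes> h))) (nhds (e_coord G \<one>))"
    using eventually_e_param_carrier
    by eventually_elim (use g h in \<open>simp add: m_assoc inv_mult_group\<close>)
  have "((\<lambda>x. e_coord G (g \<otimes> h \<otimes> e_param G x \<otimes> inv (g \<otimes> h))) has_derivative
      (\<lambda>\<eta>. Ad G g (Ad G h \<eta>))) (at (e_coord G \<one>))"
    using has_derivative_conj[OF Ad_has_derivative[OF g] h] ev
    by (rule has_derivative_transform_nhds)
  from has_derivative_unique[OF this Ad_has_derivative] show ?thesis
    using g h by (metis m_closed)
qed

lemma Ad_one: "Ad G \<one> \<eta> = \<eta>"
proof -
  have ev: "eventually (\<lambda>x. x = e_coord G (\<one> \<otimes> e_param G x \<otimes> inv \<one>)) (nhds (e_coord G \<one>))"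
    using eventually_e_param_carrier eventually_e_coord_e_param by eventually_elim simp
  have "((\<lambda>x. e_coord G (\<one> \<otimes> e_param G x \<otimes> inv \<one>)) has_derivative (\<lambda>\<eta>. \<eta>)) (at (e_coord G \<one>))"
    using has_derivative_ident ev by (rule has_derivative_transform_nhds)
  from has_derivative_unique[OF this Ad_has_derivative] show ?thesis by (metis one_closed)
qed

lemma Ad_star_apply:
  "g \<in> carrier G \<Longrightarrow> blinfun_apply (Ad_star G g \<mu>) \<eta> = blinfun_apply \<mu> (Ad G g \<eta>)"
  by (simp add: Ad_star_def bounded_linear_Blinfun_apply bounded_linear_Ad)

lemma Ad_star_mult:
  assumes "g \<in> carrier G" and "h \<in> carrier G"
  shows "Ad_star G (g \<otimes> h) \<mu> = Ad_star G h (Ad_star G g \<mu>)"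
  by (rule blinfun_eqI) (use assms in \<open>simp add: Ad_star_apply Ad_mult\<close>)

lemma Ad_star_diff: "Ad_star G g (\<mu> - \<nu>) = Ad_star G g \<mu> - Ad_star G g \<nu>"
  by (rule blinfun_eqI) (simp add: Ad_star_def blinfun.diff_left)

lemma Ad_star_add: "Ad_star G g (\<mu> + \<nu>) = Ad_star G g \<mu> + Ad_star G g \<nu>"
  by (rule blinfun_eqI) (simp add: Ad_star_def blinfun.add_left)

end

section \<open>The infinitesimal action and the diamond operation\<close>

locale lie_group_rep = lie_group G for G :: "('g, 'e::real_normed_vector) lie_struct" (structure) +
  fixes \<rho> :: "'g \<Rightarrow> 'v::real_normed_vector \<Rightarrow> 'v"
  assumes rep: "lie_representation G \<rho>"
begin

lemma rep_action: "group_action G UNIV \<rho>" and rep_linear: "g \<in> carrier G \<Longrightarrow> linear (\<rho> g)"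
  and rep_smooth: "smooth_map (prod_mfd (mfd G) vec_mfd) vec_mfd (\<lambda>(g, v). \<rho> g v)"
  using rep by (auto simp: lie_representation_def)

lemma rep_mult: "g \<in> carrier G \<Longrightarrow> h \<in> carrier G \<Longrightarrow> \<rho> (g \<otimes> h) v = \<rho> g (\<rho> h v)"
  using group_action.composition_rule[OF rep_action] by simp

lemma rep_one: "\<rho> \<one> v = v"
  using group_action.id_eq_one[OF rep_action] by (metis UNIV_I restrict_apply)

lemma bounded_linear_rep:
  assumes g: "g \<in> carrier G"
  shows "bounded_linear (\<rho> g)"
proof -
  obtain U \<phi> where U: "(U, \<phi>) \<in> snd (mfd G)" "g \<in> U" using chart_exists[OF g] .
  note chart = atlas_chart[OF U(1)]
  have "(\<lambda>v. id (\<rho> g (inv_into UNIV id v))) differentiable (at (id 0))"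
    by (rule smooth_map_snd_differentiable[OF rep_smooth U(1) vec_chart vec_chart])
      (use chart U in auto)
  then show ?thesis
    using rep_linear[OF g] by (intro linear_differentiable_imp_bounded_linear) auto
qed

lemma inf_act_has_derivative:
  "((\<lambda>x. \<rho> (e_param G x) v) has_derivative (\<lambda>\<xi>. inf_act G \<rho> \<xi> v)) (at (e_coord G \<one>))"
proof -
  note cE = atlas_chart[OF e_chart_pair]
  have "(\<lambda>x. id (\<rho> (e_param G x) v)) differentiable (at (e_coord G \<one>))"
    unfolding e_param_eq
    by (rule smooth_map_fst_differentiable[OF rep_smooth e_chart_pair vec_chart vec_chart])
      (use cE e_chart_at_one in auto)
  then show ?thesis
    using right_deriv_one_has_derivative[of "\<lambda>g. \<rho> g v"] by (simp add: inf_act_def[abs_def])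
qed

lemma bounded_linear_inf_act: "bounded_linear (\<lambda>\<xi>. inf_act G \<rho> \<xi> v)"
  using inf_act_has_derivative has_derivative_bounded_linear by blast

lemma inf_act_add: "inf_act G \<rho> \<xi> (u + v) = inf_act G \<rho> \<xi> u + inf_act G \<rho> \<xi> v"
proof -
  have ev: "eventually (\<lambda>x. \<rho> (e_param G x) u + \<rho> (e_param G x) v = \<rho> (e_param G x) (u + v))
      (nhds (e_coord G \<one>))"
    using eventually_e_param_carrier by eventually_elim (simp add: rep_linear linear_add)
  have "((\<lambda>x. \<rho> (e_param G x) (u + v)) has_derivative
      (\<lambda>\<xi>. inf_act G \<rho> \<xi> u + inf_act G \<rho> \<xi> v)) (at (e_coord G \<one>))"
    using has_derivative_add[OF inf_act_has_derivative[of u] inf_act_has_derivative[of v]] ev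
    by (rule has_derivative_transform_nhds)
  from has_derivative_unique[OF this inf_act_has_derivative] show ?thesis by metis
qed

lemma inf_act_scaleR: "inf_act G \<rho> \<xi> (c *\<^sub>R v) = c *\<^sub>R inf_act G \<rho> \<xi> v"
proof -
  have ev: "eventually (\<lambda>x. c *\<^sub>R \<rho> (e_param G x) v = \<rho> (e_param G x) (c *\<^sub>R v))
      (nhds (e_coord G \<one>))"
    using eventually_e_param_carrier by eventually_elim (simp add: rep_linear linear_scale)
  have "((\<lambda>x. \<rho> (e_param G x) (c *\<^sub>R v)) has_derivative (\<lambda>\<xi>. c *\<^sub>R inf_act G \<rho> \<xi> v)) (at (e_coord G \<one>))"
    using has_derivative_scaleR_right[OF inf_act_has_derivative[of v], of c] ev
    by (rule has_derivative_transform_nhds)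
  from has_derivative_unique[OF this inf_act_has_derivative] show ?thesis by metis
qed

text \<open>Both sides are the derivative of \<open>\<rho> (g \<otimes> x \<otimes> inv g) (\<rho> g v) = \<rho> g (\<rho> x v)\<close> with respect to \<open>x\<close> at
  the identity.\<close>
lemma inf_act_Ad:
  assumes g: "g \<in> carrier G"
  shows "inf_act G \<rho> (Ad G g \<xi>) (\<rho> g v) = \<rho> g (inf_act G \<rho> \<xi> v)"
proof -
  have ev: "eventually (\<lambda>x. \<rho> (g \<otimes> e_param G x \<otimes> inv g) (\<rho> g v) = \<rho> g (\<rho> (e_param G x) v))
      (nhds (e_coord G \<one>))"
    using eventually_e_param_carrier
    by eventually_elim (use g in \<open>simp add: rep_mult[symmetric] m_assoc\<close>)
  have "((\<lambda>x. \<rho> g (\<rho> (e_param G x) v)) has_derivative (\<lambda>\<xi>. inf_act G \<rho> (Ad G g \<xi>) (\<rho> g v)))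
      (at (e_coord G \<one>))"
    using has_derivative_conj[OF inf_act_has_derivative g, of "\<rho> g v"] ev
    by (rule has_derivative_transform_nhds)
  moreover have "((\<lambda>x. \<rho> g (\<rho> (e_param G x) v)) has_derivative (\<lambda>\<xi>. \<rho> g (inf_act G \<rho> \<xi> v)))
      (at (e_coord G \<one>))"
    by (rule bounded_linear.has_derivative[OF bounded_linear_rep[OF g] inf_act_has_derivative])
  ultimately show ?thesis by (metis has_derivative_unique)
qed

text \<open>The inverse is part of the coadjoint action. It cancels the one in \<open>dual_act\<close>, so that
  the combination is a right action, like \<open>Ad_star\<close>.\<close>
lemma dual_act_inv_apply:
  "g \<in> carrier G \<Longrightarrow> blinfun_apply (dual_act G \<rho> (inv g) \<alpha>) v = blinfun_apply \<alpha> (\<rho> g v)"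
  by (simp add: dual_act_def bounded_linear_Blinfun_apply bounded_linear_rep)

lemma dual_act_inv_mult:
  assumes "g \<in> carrier G" and "h \<in> carrier G"
  shows "dual_act G \<rho> (inv (g \<otimes> h)) \<alpha> = dual_act G \<rho> (inv h) (dual_act G \<rho> (inv g) \<alpha>)"
  by (rule blinfun_eqI) (use assms in \<open>simp add: dual_act_inv_apply rep_mult\<close>)

lemma dual_act_inv_one: "dual_act G \<rho> (inv \<one>) \<alpha> = \<alpha>"
  by (rule blinfun_eqI) (simp add: dual_act_inv_apply rep_one del: inv_one)

lemma diamond_apply: "blinfun_apply (diamond G \<rho> v \<alpha>) \<xi> = blinfun_apply \<alpha> (inf_act G \<rho> \<xi> v)"
proof -
  have "bounded_linear (\<lambda>\<xi>. blinfun_apply \<alpha> (inf_act G \<rho> \<xi> v))"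
    by (rule bounded_linear_compose[OF blinfun.bounded_linear_right bounded_linear_inf_act])
  then show ?thesis by (simp add: diamond_def bounded_linear_Blinfun_apply)
qed

lemma diamond_add: "diamond G \<rho> (u + v) \<alpha> = diamond G \<rho> u \<alpha> + diamond G \<rho> v \<alpha>"
  by (rule blinfun_eqI) (simp add: diamond_apply inf_act_add blinfun.add_left blinfun.add_right)

lemma diamond_scaleR: "diamond G \<rho> (c *\<^sub>R v) \<alpha> = c *\<^sub>R diamond G \<rho> v \<alpha>"
  by (rule blinfun_eqI) (simp add: diamond_apply inf_act_scaleR blinfun.scaleR_left blinfun.scaleR_right)

lemma diamond_zero: "diamond G \<rho> 0 \<alpha> = 0"
  using diamond_scaleR[of 0 0] by simp

text \<open>This is \<open>inf_act_Ad\<close> dualized. It moves a translation past the coadjoint action of a group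
  element.\<close>
lemma Ad_star_diamond:
  assumes "g \<in> carrier G"
  shows "Ad_star G g (diamond G \<rho> (\<rho> g v) \<alpha>) = diamond G \<rho> v (dual_act G \<rho> (inv g) \<alpha>)"
  by (rule blinfun_eqI) (use assms in \<open>simp add: Ad_star_apply diamond_apply inf_act_Ad dual_act_inv_apply\<close>)

section \<open>Coadjoint orbits of the semidirect product\<close>

text \<open>The coadjoint action is a right action of the semidirect product: \<open>(g \<otimes> h, \<rho> g w + u)\<close> is
  the product \<open>(g, u) (h, w)\<close>. The translation by \<open>w\<close> takes place after \<open>g\<close> has acted;
  \<open>Ad_star_diamond\<close> moves it to the front, where \<open>w\<close> becomes \<open>\<rho> g w\<close>.\<close>
lemma coadjoint_mult:
  assumes "g \<in> carrier G" and "h \<in> carrier G"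
  shows "coadjoint G \<rho> (h, w) (coadjoint G \<rho> (g, u) x) = coadjoint G \<rho> (g \<otimes> h, \<rho> g w + u) x"
  using assms
  by (cases x) (simp add: coadjoint_def Ad_star_mult Ad_star_diff Ad_star_add dual_act_inv_mult diamond_add
      Ad_star_diamond[symmetric] algebra_simps)

lemma coadjoint_one: "coadjoint G \<rho> (\<one>, 0) x = x"
proof -
  have "Ad_star G \<one> \<mu> = \<mu>" for \<mu>
    by (rule blinfun_eqI) (simp add: Ad_star_apply Ad_one)
  then show ?thesis
    by (cases x) (simp add: coadjoint_def diamond_zero dual_act_inv_one del: inv_one)
qed

lemma coadjoint_orbit_iff: "y \<in> coadjoint_orbit G \<rho> x \<longleftrightarrow> (\<exists>g\<in>carrier G. \<exists>u. y = coadjoint G \<rho> (g, u) x)"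
  by (cases x) (auto simp: coadjoint_orbit_eq coadjoint_def)

lemma coadjoint_orbit_step:
  assumes "y \<in> coadjoint_orbit G \<rho> x" and "h \<in> carrier G"
  shows "coadjoint G \<rho> (h, w) y \<in> coadjoint_orbit G \<rho> x"
  using assms coadjoint_mult unfolding coadjoint_orbit_iff by (metis m_closed)

section \<open>The integrator\<close>

text \<open>The first factor has no translation part, because the force term of the scheme acts at the
  midpoint, after the first half step and before the second.\<close>
lemma integrator_step:
  assumes "\<Delta>t > 0"
    and int: "midpoint_integrator G \<rho> \<tau> D a0 H \<Delta>t M g g' m1 m2"
    and mom: "trivialized_momenta G \<tau> D \<Delta>t M g g' m1 m2 \<mu>"
    and k: "k \<in> {1..M}"
  obtains p q u where "p \<in> carrier G" and "q \<in> carrier G"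
    and "(\<mu> k, advected G \<rho> a0 g k) =
      coadjoint G \<rho> (q, u) (coadjoint G \<rho> (p, 0) (\<mu> (k - 1), advected G \<rho> a0 g (k - 1)))"
proof -
  let ?p = "inv (g (k - 1)) \<otimes> g' k" and ?q = "inv (g' k) \<otimes> g k"
  let ?\<xi> = "xi G \<tau> D \<Delta>t g g'" and ?\<xi>' = "xi' G \<tau> D \<Delta>t g g'"
  have gc: "g k \<in> carrier G" "g (k - 1) \<in> carrier G" "g' k \<in> carrier G"
    and dom: "?q \<in> \<tau> ` D" "?p \<in> \<tau> ` D"
    using int k by (auto simp: midpoint_integrator_def)
  have \<tau>: "\<tau> (\<Delta>t *\<^sub>R ?\<xi>' k) = ?p" "\<tau> (\<Delta>t *\<^sub>R ?\<xi> k) = ?q"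
    using \<open>\<Delta>t > 0\<close> dom by (simp_all add: xi_def xi'_def f_inv_into_f)
  \<comment> \<open>\<open>?n\<close> is the momentum at the midpoint, which the two equations of the step have in common.\<close>
  let ?n = "dtau_inv_star G \<tau> D (\<Delta>t *\<^sub>R ?\<xi> k) (m2 k)"
  obtain d where d: "(1 / \<Delta>t) *\<^sub>R (Ad_star G ?p (dtau_inv_star G \<tau> D (\<Delta>t *\<^sub>R ?\<xi>' k) (m1 k)) - ?n)
      = diamond G \<rho> d (advected G \<rho> a0 g' k)"
    using int k unfolding midpoint_integrator_def Let_def \<tau>[symmetric] by blast
  have "k - 1 \<in> {0..<M}" "k - 1 + 1 = k" using k by auto
  then have \<mu>: "\<mu> (k - 1) = dtau_inv_star G \<tau> D (\<Delta>t *\<^sub>R ?\<xi>' k) (m1 k)" "\<mu> k = Ad_star G ?q ?n"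
    using mom k unfolding trivialized_momenta_def Let_def \<tau>(2)[symmetric] by metis+
  have "Ad_star G ?p (\<mu> (k - 1)) - ?n = \<Delta>t *\<^sub>R diamond G \<rho> d (advected G \<rho> a0 g' k)"
    unfolding \<mu>(1) d[symmetric] using \<open>\<Delta>t > 0\<close> by simp
  then have n: "?n = Ad_star G ?p (\<mu> (k - 1)) - diamond G \<rho> (\<Delta>t *\<^sub>R d) (advected G \<rho> a0 g' k)"
    by (simp add: diamond_scaleR algebra_simps)
  have "g (k - 1) \<otimes> ?p = g' k" "g' k \<otimes> ?q = g k"
    using gc by (simp_all add: m_assoc[symmetric])
  \<comment> \<open>The advected parameter is transported by the same group elements as the momentum.\<close>
  then have adv: "advected G \<rho> a0 g' k = dual_act G \<rho> (inv ?p) (advected G \<rho> a0 g (k - 1))"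
      "advected G \<rho> a0 g k = dual_act G \<rho> (inv ?q) (advected G \<rho> a0 g' k)"
    using gc unfolding advected_def by (metis dual_act_inv_mult inv_closed m_closed)+
  have "(\<mu> k, advected G \<rho> a0 g k) =
      coadjoint G \<rho> (?q, \<Delta>t *\<^sub>R d) (coadjoint G \<rho> (?p, 0) (\<mu> (k - 1), advected G \<rho> a0 g (k - 1)))"
    by (simp add: coadjoint_def diamond_zero \<mu>(2) n adv)
  then show thesis by (rule that[rotated 2]) (use gc in auto)
qed

end

theorem proposition5p4:
  fixes G :: "('g, 'e::real_normed_vector) lie_struct"
    and \<rho> :: "'g \<Rightarrow> 'v::real_normed_vector \<Rightarrow> 'v"
    and a0 :: "'v \<Rightarrow>\<^sub>L real"
    and h :: "('e \<Rightarrow>\<^sub>L real) \<times> ('v \<Rightarrow>\<^sub>L real) \<Rightarrow> real"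
    and hs :: "nat \<Rightarrow> ('e \<Rightarrow>\<^sub>L real) \<times> ('v \<Rightarrow>\<^sub>L real) \<Rightarrow> real"
    and \<tau> :: "'e \<Rightarrow> 'g" and D :: "'e set"
    and P :: "'w measure" and W :: "nat \<Rightarrow> real \<Rightarrow> 'w \<Rightarrow> real" and \<omega> :: 'w
    and \<Delta>t :: real and N M :: nat
    and \<Delta>W :: "nat \<Rightarrow> nat \<Rightarrow> real"
    and g g' :: "nat \<Rightarrow> 'g" and m1 m2 \<mu> :: "nat \<Rightarrow> 'e \<Rightarrow>\<^sub>L real"
    and \<alpha> :: "nat \<Rightarrow> 'v \<Rightarrow>\<^sub>L real"
  assumes "lie_group G" and "lie_representation G \<rho>"
    and "smooth_reduced G \<rho> a0 h" and "\<And>i. i \<in> {1..N} \<Longrightarrow> smooth_reduced G \<rho> a0 (hs i)"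
    and "lie_retraction G \<tau> D"
    and "\<Delta>t > 0" and "M \<ge> 1"
    and "independent_wiener_processes P N W" and "\<omega> \<in> space P"
    and "\<Delta>W = (\<lambda>i k. W i (real k * \<Delta>t) \<omega> - W i (real (k - 1) * \<Delta>t) \<omega>)"
    and "midpoint_integrator G \<rho> \<tau> D a0 (step_hamiltonian h hs N \<Delta>t \<Delta>W) \<Delta>t M g g' m1 m2"
    and "trivialized_momenta G \<tau> D \<Delta>t M g g' m1 m2 \<mu>"
    and "\<alpha> = advected G \<rho> a0 g"
  shows "(\<forall>k\<in>{0..M}. (\<mu> k, \<alpha> k) \<in> coadjoint_orbit G \<rho> (\<mu> 0, \<alpha> 0)) \<and>
    (\<forall>C. casimir G \<rho> C \<longrightarrow> (\<forall>k\<in>{0..M}. C (\<mu> k, \<alpha> k) = C (\<mu> 0, \<alpha> 0)))"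
proof -
  from assms(1,2) interpret lie_group_rep G \<rho>
    by (simp add: lie_group_rep_def lie_group_rep_axioms_def)
  have orbit: "(\<mu> k, \<alpha> k) \<in> coadjoint_orbit G \<rho> (\<mu> 0, \<alpha> 0)" if "k \<le> M" for k
    using that
  proof (induction k)
    case 0
    show ?case unfolding coadjoint_orbit_iff using coadjoint_one by (metis one_closed)
  next
    case (Suc k)
    then have "Suc k \<in> {1..M}" by simp
    from integrator_step[OF assms(6,11,12) this] show ?case
      using Suc assms(13) by (metis Suc_leD coadjoint_orbit_step diff_Suc_1)
  qed
  then show ?thesis by (auto simp: casimir_def)
qed

end
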